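(* Let $\mathcal{H}$ be a complex Hilbert space and let $T$ be an arbitrary bounded linear operator on $\mathcal{H}$, with Aluthge transform $\Delta(T)$ and mean transform $\widehat{T}$. Then $$w(\Delta(T))\leq w(\widehat{T})\leq w(T).$$
   Context: For a bounded operator $T$, $|T|:=(T^*T)^{1/2}$, and the canonical polar decomposition is $T=V|T|$ where $V$ is the partial isometry with null space $\mathcal{N}(V)=\mathcal{N}(T)$. The mean transform of $T$ is $\widehat{T}:=\frac12(V|T|+|T|V)$ and the Aluthge transform of $T$ is $\Delta(T):=|T|^{1/2}V|T|^{1/2}$, where $T=V|T|$ is the canonical polar decomposition. The numerical radius is $w(T):=\sup\{|\langle Tx,x\rangle| : x\in\mathcal{H},\ \|x\|=1\}$. *)

theory Defs
  imports Complex_Main "HOL-Library.Nonpos_Ints"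
begin

(* Complex Hilbert spaces as a type class over the real normed spaces of the library.  The
   inherited real scalar multiplication and norm are tied to the complex structure by
   scaleR_scaleC and norm_eq_sqrt_cinner.  The inner product is linear in its first argument. *)

class complex_inner = real_normed_vector +
  fixes scaleC :: "complex \<Rightarrow> 'a \<Rightarrow> 'a" (infixr \<open>*\<^sub>C\<close> 75)
    and cinner :: "'a \<Rightarrow> 'a \<Rightarrow> complex"
  assumes scaleC_add_right: "a *\<^sub>C (x + y) = a *\<^sub>C x + a *\<^sub>C y"
    and scaleC_add_left: "(a + b) *\<^sub>C x = a *\<^sub>C x + b *\<^sub>C x"
    and scaleC_scaleC: "a *\<^sub>C (b *\<^sub>C x) = (a * b) *\<^sub>C x"
    and scaleC_one: "1 *\<^sub>C x = x"
    and scaleR_scaleC: "r *\<^sub>R x = complex_of_real r *\<^sub>C x"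
    and cinner_commute: "cinner x y = cnj (cinner y x)"
    and cinner_add_left: "cinner (x + y) z = cinner x z + cinner y z"
    and cinner_scaleC_left: "cinner (a *\<^sub>C x) y = a * cinner x y"
    and cinner_ge_zero: "cinner x x \<in> \<real>\<^sub>\<ge>\<^sub>0"
    and cinner_eq_zero_iff: "cinner x x = 0 \<longleftrightarrow> x = 0"
    and norm_eq_sqrt_cinner: "norm x = sqrt (cmod (cinner x x))"

class complex_hilbert_space = complex_inner + complete_space

instantiation complex :: complex_hilbert_space
begin

definition scaleC_complex :: "complex \<Rightarrow> complex \<Rightarrow> complex"
  where "scaleC_complex a x = a * x"

definition cinner_complex :: "complex \<Rightarrow> complex \<Rightarrow> complex"
  where "cinner_complex x y = x * cnj y"

instance
proof
  fix x :: complex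
  show "cinner x x \<in> \<real>\<^sub>\<ge>\<^sub>0"
    by (simp add: cinner_complex_def complex_nonneg_Reals_iff)
qed (auto simp: scaleC_complex_def cinner_complex_def algebra_simps scaleR_conv_of_real norm_mult)

end

definition bounded_clinear :: "('a::complex_inner \<Rightarrow> 'a) \<Rightarrow> bool" where
  "bounded_clinear T \<longleftrightarrow> bounded_linear T \<and> (\<forall>c x. T (c *\<^sub>C x) = c *\<^sub>C T x)"

(* Each definite description below denotes the intended object only for suitable arguments:
   a bounded operator T for cadjoint, abs_op and polar_isometry, a positive operator P for
   sqrt_op. *)

definition cadjoint :: "('a::complex_hilbert_space \<Rightarrow> 'a) \<Rightarrow> 'a \<Rightarrow> 'a" where
  "cadjoint T = (THE S. \<forall>x y. cinner (T x) y = cinner x (S y))"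

definition positive_op :: "('a::complex_hilbert_space \<Rightarrow> 'a) \<Rightarrow> bool" where
  "positive_op P \<longleftrightarrow> bounded_clinear P \<and> (\<forall>x. cinner (P x) x \<in> \<real>\<^sub>\<ge>\<^sub>0)"

definition sqrt_op :: "('a::complex_hilbert_space \<Rightarrow> 'a) \<Rightarrow> 'a \<Rightarrow> 'a" where
  "sqrt_op P = (THE R. positive_op R \<and> R \<circ> R = P)"

definition abs_op :: "('a::complex_hilbert_space \<Rightarrow> 'a) \<Rightarrow> 'a \<Rightarrow> 'a" where
  "abs_op T = sqrt_op (cadjoint T \<circ> T)"

definition null_space :: "('a::complex_hilbert_space \<Rightarrow> 'a) \<Rightarrow> 'a set" where
  "null_space T = {x. T x = 0}"

definition orth_complement :: "'a::complex_hilbert_space set \<Rightarrow> 'a set" where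
  "orth_complement S = {x. \<forall>y\<in>S. cinner x y = 0}"

definition partial_isometry :: "('a::complex_hilbert_space \<Rightarrow> 'a) \<Rightarrow> bool" where
  "partial_isometry V \<longleftrightarrow>
     bounded_clinear V \<and> (\<forall>x \<in> orth_complement (null_space V). norm (V x) = norm x)"

definition polar_isometry :: "('a::complex_hilbert_space \<Rightarrow> 'a) \<Rightarrow> 'a \<Rightarrow> 'a" where
  "polar_isometry T =
     (THE V. partial_isometry V \<and> null_space V = null_space T \<and> T = V \<circ> abs_op T)"

definition mean_transform :: "('a::complex_hilbert_space \<Rightarrow> 'a) \<Rightarrow> 'a \<Rightarrow> 'a" where
  "mean_transform T =
     (\<lambda>x. (1/2) *\<^sub>R (polar_isometry T (abs_op T x) + abs_op T (polar_isometry T x)))"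

definition aluthge_transform :: "('a::complex_hilbert_space \<Rightarrow> 'a) \<Rightarrow> 'a \<Rightarrow> 'a" where
  "aluthge_transform T = sqrt_op (abs_op T) \<circ> polar_isometry T \<circ> sqrt_op (abs_op T)"

(* On the zero space the supremum is over the empty set, where Sup on the reals is an
   unspecified constant; the value is then the same for every operator. *)
definition numerical_radius :: "('a::complex_hilbert_space \<Rightarrow> 'a) \<Rightarrow> real" where
  "numerical_radius T = (SUP x\<in>{x. norm x = 1}. cmod (cinner (T x) x))"

end

theory Submission
  imports Defs
begin

text \<open>Write \<open>P = |T|\<close>, \<open>B = P\<^sup>1\<^sup>/\<^sup>2\<close> and \<open>T = V P\<close>.  Since \<open>V\<^sup>* V\<close> fixes the range of \<open>P\<close>, one has
  \<open>\<langle>P V x, x\<rangle> = \<langle>T V x, V x\<rangle>\<close>, which bounds the numerical radius of \<open>P V\<close>, hence of the mean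
  transform, by that of \<open>T\<close>.  For the Aluthge transform \<open>B V B\<close>, rotate \<open>V\<close> and let \<open>X\<close> be its real
  part: an approximate eigenvector \<open>x\<close> of \<open>B X B\<close> for the top \<open>\<lambda>\<close> of its numerical range gives an
  approximate eigenvector \<open>y = B x\<close> of \<open>P X\<close>, so that \<open>Re \<langle>P X y, y\<rangle>\<close>, which is a value of the
  rotated mean transform, is nearly \<open>\<lambda> \<parallel>y\<parallel>\<^sup>2\<close>.  Square roots of positive contractions are
  obtained from the iteration \<open>Y\<^sub>n\<^sub>+\<^sub>1 = (1 - A + Y\<^sub>n\<^sup>2) / 2\<close>, whose limit \<open>Y\<close> satisfies
  \<open>(1 - Y)\<^sup>2 = A\<close>.\<close>

section \<open>Complex inner product spaces\<close>

lemma cinner_add_right: "cinner x (y + z) = cinner x y + cinner x z"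
  by (metis cinner_add_left cinner_commute complex_cnj_add)

lemma cinner_scaleC_right: "cinner x (a *\<^sub>C y) = cnj a * cinner x y"
  by (metis cinner_scaleC_left cinner_commute complex_cnj_mult)

lemma cinner_self: "cinner x x = complex_of_real ((norm x)\<^sup>2)"
proof -
  have "cinner x x = complex_of_real (cmod (cinner x x))"
    using cinner_ge_zero[of x] by (simp add: complex_nonneg_Reals_iff complex_eq_iff cmod_def)
  then show ?thesis
    by (metis norm_eq_sqrt_cinner norm_ge_zero real_sqrt_pow2)
qed

lemma scaleC_minus_one: "(-1) *\<^sub>C x = - x" for x :: "'a::complex_inner"
  by (metis of_real_1 of_real_minus scaleR_scaleC scaleR_minus1_left)

lemma norm_scaleC: "norm (a *\<^sub>C x) = cmod a * norm x" for x :: "'a::complex_inner"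
  unfolding norm_eq_sqrt_cinner[where 'a = 'a]
  by (simp add: cinner_scaleC_left cinner_scaleC_right norm_mult real_sqrt_mult)

lemma cinner_scaleR_left: "cinner (r *\<^sub>R x) y = complex_of_real r * cinner x y"
  by (simp add: scaleR_scaleC cinner_scaleC_left)

lemma cinner_scaleR_right: "cinner x (r *\<^sub>R y) = complex_of_real r * cinner x y"
  by (simp add: scaleR_scaleC cinner_scaleC_right)

lemma cinner_minus_left: "cinner (- x) y = - cinner x y"
  using cinner_scaleR_left[of "-1" x y] by simp

lemma cinner_minus_right: "cinner x (- y) = - cinner x y"
  using cinner_scaleR_right[of x "-1" y] by simp

lemma cinner_diff_left: "cinner (x - y) z = cinner x z - cinner y z"
  using cinner_add_left[of x "-y" z] by (simp add: cinner_minus_left)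

lemma cinner_diff_right: "cinner x (y - z) = cinner x y - cinner x z"
  using cinner_add_right[of x y "-z"] by (simp add: cinner_minus_right)

lemma cinner_zero_left [simp]: "cinner 0 y = 0"
  using cinner_diff_left[of 0 0 y] by simp

lemma cinner_zero_right [simp]: "cinner x 0 = 0"
  using cinner_diff_right[of x 0 0] by simp

lemmas cinner_simps = cinner_add_left cinner_add_right cinner_diff_left cinner_diff_right
  cinner_scaleC_left cinner_scaleC_right cinner_scaleR_left cinner_scaleR_right

lemma Re_cinner_commute: "Re (cinner x y) = Re (cinner y x)"
  by (subst cinner_commute) simp

lemma norm_add_sq: "(norm (x + y))\<^sup>2 = (norm x)\<^sup>2 + 2 * Re (cinner x y) + (norm y)\<^sup>2"
  for x y :: "'a::complex_inner"
proof -
  have "(norm (x + y))\<^sup>2 = Re (cinner (x + y) (x + y))"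
    by (simp add: cinner_self)
  also have "\<dots> = (norm x)\<^sup>2 + 2 * Re (cinner x y) + (norm y)\<^sup>2"
    using Re_cinner_commute[of x y] by (simp only: cinner_add_left cinner_add_right) (simp add: cinner_self)
  finally show ?thesis .
qed

lemma norm_diff_sq: "(norm (x - y))\<^sup>2 = (norm x)\<^sup>2 - 2 * Re (cinner x y) + (norm y)\<^sup>2"
  for x y :: "'a::complex_inner"
  using norm_add_sq[of x "- y"] by (simp add: cinner_minus_right)

text \<open>The triangle inequality belongs to the class of normed spaces, so the usual order is
  reversed: squaring it yields Cauchy-Schwarz for real parts.\<close>

lemma Re_cinner_le: "Re (cinner x y) \<le> norm x * norm y" for x y :: "'a::complex_inner"
proof -
  have "(norm (x + y))\<^sup>2 \<le> (norm x + norm y)\<^sup>2"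
    by (intro power_mono norm_triangle_ineq norm_ge_zero)
  then show ?thesis
    by (simp add: norm_add_sq power2_sum)
qed

text \<open>Upgrades estimates of real parts to estimates of moduli, for Cauchy-Schwarz here and for
  the reduction to self-adjoint operators later.\<close>

lemma exists_rotation: obtains u where "cmod u = 1" "u * z = complex_of_real (cmod z)"
proof (cases "z = 0")
  case True
  then show ?thesis using that[of 1] by simp
next
  case False
  have "cnj (sgn z) * z = complex_of_real (cmod z)"
    using False by (simp add: sgn_eq complex_norm_square[symmetric] mult.commute power2_eq_square)
  then show ?thesis using that[of "cnj (sgn z)"] False by (simp add: norm_sgn)
qed

lemma cmod_cinner_le: "cmod (cinner x y) \<le> norm x * norm y" for x y :: "'a::complex_inner"
proof -
  obtain u where u: "cmod u = 1" "u * cinner x y = complex_of_real (cmod (cinner x y))"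
    by (rule exists_rotation)
  have "cmod (cinner x y) = Re (cinner (u *\<^sub>C x) y)"
    by (simp add: cinner_scaleC_left u)
  also have "\<dots> \<le> norm x * norm y"
    using Re_cinner_le[of "u *\<^sub>C x" y] u by (simp add: norm_scaleC)
  finally show ?thesis .
qed

lemma bounded_bilinear_cinner:
  "bounded_bilinear (cinner :: 'a::complex_inner \<Rightarrow> 'a \<Rightarrow> complex)"
proof
  show "\<exists>K. \<forall>a b::'a. norm (cinner a b) \<le> norm a * norm b * K"
    by (intro exI[of _ 1]) (simp add: cmod_cinner_le)
qed (simp_all only: cinner_add_left cinner_add_right cinner_scaleR_left cinner_scaleR_right
    scaleR_conv_of_real)

lemmas tendsto_cinner = bounded_bilinear.tendsto[OF bounded_bilinear_cinner]

lemma cinner_ext: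
  assumes "\<And>x. cinner x y = cinner x z"
  shows "y = z"
  using assms[of "y - z"] cinner_eq_zero_iff[of "y - z"] by (simp add: cinner_diff_right)

text \<open>Opens the comparison test for series, on which the convergence of
  \<open>sqrt_iter\<close> rests.\<close>

instance complex_hilbert_space \<subseteq> banach ..

section \<open>Bounded operators and the Riesz theorem\<close>

lemma bounded_clinearD:
  assumes "bounded_clinear T"
  shows "bounded_linear T" "T (c *\<^sub>C x) = c *\<^sub>C T x" "T (x + y) = T x + T y"
    "T (x - y) = T x - T y" "T (r *\<^sub>R x) = r *\<^sub>R T x" "T 0 = 0"
proof -
  show bl: "bounded_linear T" and "T (c *\<^sub>C x) = c *\<^sub>C T x"
    using assms by (auto simp: bounded_clinear_def)
  then interpret bounded_linear T by simp
  show "T (x + y) = T x + T y" "T (x - y) = T x - T y" "T (r *\<^sub>R x) = r *\<^sub>R T x" "T 0 = 0"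
    by (simp_all add: add diff scaleR zero)
qed

lemma bounded_clinearI:
  assumes "\<And>x y. T (x + y) = T x + T y" "\<And>c x. T (c *\<^sub>C x) = c *\<^sub>C T x"
    "\<And>x. norm (T x) \<le> norm x * K"
  shows "bounded_clinear T"
  unfolding bounded_clinear_def
  using assms by (auto intro!: bounded_linear_intro[of _ K] simp: scaleR_scaleC)

lemma bounded_clinear_bound:
  assumes "bounded_clinear T"
  obtains K where "K > 0" "\<And>x. norm (T x) \<le> K * norm x"
  using bounded_linear.pos_bounded[OF bounded_clinearD(1)[OF assms]] by (metis mult.commute)

lemma bounded_clinear_id: "bounded_clinear (\<lambda>x. x)"
  by (auto simp: bounded_clinear_def bounded_linear_ident)

lemma bounded_clinear_scaleC:
  assumes "bounded_clinear S"
  shows "bounded_clinear (\<lambda>x. a *\<^sub>C S x)"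
proof -
  obtain K where K: "K > 0" "\<And>x. norm (S x) \<le> K * norm x"
    using bounded_clinear_bound[OF assms] by blast
  show ?thesis
  proof (rule bounded_clinearI)
    show "norm (a *\<^sub>C S x) \<le> norm x * (cmod a * K)" for x
      using mult_left_mono[OF K(2)[of x] norm_ge_zero[of a]] by (simp add: norm_scaleC mult_ac)
  qed (simp_all add: bounded_clinearD[OF assms] scaleC_add_right scaleC_scaleC mult.commute)
qed

lemma LIMSEQ_scaleC:
  fixes l :: "'a::complex_inner"
  assumes "f \<longlonglongrightarrow> l"
  shows "(\<lambda>n. c *\<^sub>C f n) \<longlonglongrightarrow> c *\<^sub>C l"
  using bounded_linear.tendsto[OF bounded_clinearD(1)[OF bounded_clinear_scaleC[OF
      bounded_clinear_id]] assms] .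

lemma bounded_clinear_scaleR:
  "bounded_clinear S \<Longrightarrow> bounded_clinear (\<lambda>x. r *\<^sub>R S x)"
  by (simp add: scaleR_scaleC bounded_clinear_scaleC)

lemma bounded_clinear_add:
  assumes "bounded_clinear S" "bounded_clinear T"
  shows "bounded_clinear (\<lambda>x. S x + T x)"
  using assms by (auto simp: bounded_clinear_def bounded_linear_add scaleC_add_right)

lemma bounded_clinear_diff:
  assumes "bounded_clinear S" "bounded_clinear T"
  shows "bounded_clinear (\<lambda>x. S x - T x)"
  using bounded_clinear_add[OF assms(1) bounded_clinear_scaleC[OF assms(2), of "-1"]]
  by (simp add: scaleC_minus_one)

lemma bounded_clinear_compose:
  assumes "bounded_clinear S" "bounded_clinear T"
  shows "bounded_clinear (\<lambda>x. S (T x))"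
  using assms by (auto simp: bounded_clinear_def intro: bounded_linear_compose)

lemma bounded_clinear_comp:
  "bounded_clinear S \<Longrightarrow> bounded_clinear T \<Longrightarrow> bounded_clinear (S \<circ> T)"
  by (simp add: comp_def bounded_clinear_compose)

text \<open>First-order condition at a minimum, with \<open>d\<close> half the derivative at
  \<open>t = 0\<close>.\<close>

lemma linear_coeff_zero:
  fixes d q :: real
  assumes q: "q \<ge> 0" and *: "\<And>t. 0 \<le> 2 * t * d + t\<^sup>2 * q"
  shows "d = 0"
proof -
  \<comment> \<open>The exact minimiser would divide by \<open>q\<close>, which may be zero;
    \<open>q + 1\<close> still gives a negative value unless \<open>d = 0\<close>.\<close>
  define t where "t = - d / (q + 1)"
  have d: "d = - t * (q + 1)" using q by (simp add: t_def)
  have "2 * t * d + t\<^sup>2 * q = - (t\<^sup>2 * (q + 2))"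
    unfolding d by (simp add: power2_eq_square algebra_simps)
  with *[of t] have "t\<^sup>2 * (q + 2) \<le> 0" by simp
  then have "t = 0" using q by (simp add: mult_le_0_iff)
  then show ?thesis by (simp add: d)
qed

text \<open>Riesz representation of a functional on the range of \<open>Q\<close>, by minimising
  \<open>\<parallel>Q z\<parallel>\<^sup>2 - 2 Re (g z)\<close>.  The range need not be closed, and the representing vector is a limit
  of vectors in it; the case \<open>Q = id\<close> yields adjoints, and other choices of \<open>Q\<close> yield orthogonal
  projections and the polar decomposition.\<close>

lemma riesz_on_range:
  fixes Q :: "'a::complex_hilbert_space \<Rightarrow> 'a" and g :: "'a \<Rightarrow> complex"
  assumes Q: "bounded_clinear Q"
    and g_add: "\<And>x y. g (x + y) = g x + g y"
    and g_scale: "\<And>c x. g (c *\<^sub>C x) = c * g x"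
    and g_bound: "\<And>x. cmod (g x) \<le> C * norm (Q x)"
  obtains r m where "(\<lambda>n. Q (m n)) \<longlonglongrightarrow> r" "\<And>z. g z = cinner (Q z) r"
proof -
  define J where "J z = (norm (Q z))\<^sup>2 - 2 * Re (g z)" for z
  define I where "I = (INF z. J z)"
  note Qs = bounded_clinearD[OF Q]
  have g_scaleR: "g (t *\<^sub>R x) = complex_of_real t * g x" for t x
    by (simp add: scaleR_scaleC g_scale)
  \<comment> \<open>Completing the square in \<open>norm (Q z)\<close>.\<close>
  have J_ge: "J z \<ge> - C\<^sup>2" for z
  proof -
    have "Re (g z) \<le> C * norm (Q z)"
      using complex_Re_le_cmod[of "g z"] g_bound[of z] by linarith
    moreover have "0 \<le> (norm (Q z) - C)\<^sup>2" by simp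
    ultimately show ?thesis
      unfolding J_def power2_diff by (simp add: mult.commute)
  qed
  then have bdd: "bdd_below (range J)"
    by (intro bdd_belowI[of _ "- C\<^sup>2"]) blast
  have I_le: "I \<le> J z" for z
    unfolding I_def using bdd by (rule cINF_lower) simp
  have "\<exists>z. J z < I + 1 / Suc n" for n
  proof -
    have "(INF z. J z) < I + 1 / Suc n" by (simp add: I_def)
    then show ?thesis using cINF_less_iff[OF _ bdd] by auto
  qed
  then obtain m where m: "\<And>n. J (m n) < I + 1 / Suc n" by metis
  \<comment> \<open>Parallelogram law, with \<open>I\<close> as lower bound for \<open>J\<close> at
    the midpoint: near-minimisers have nearby images under \<open>Q\<close>.\<close>
  have midpoint: "(norm (Q a - Q b))\<^sup>2 \<le> 2 * (J a - I) + 2 * (J b - I)" for a b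
  proof -
    have "4 * J ((1/2) *\<^sub>R (a + b)) = (norm (Q a + Q b))\<^sup>2 - 4 * (Re (g a) + Re (g b))"
      by (simp add: J_def Qs g_scaleR g_add power_divide add_divide_distrib)
    then have "(norm (Q a - Q b))\<^sup>2 = 2 * J a + 2 * J b - 4 * J ((1/2) *\<^sub>R (a + b))"
      by (simp add: norm_add_sq norm_diff_sq J_def)
    then show ?thesis using I_le[of "(1/2) *\<^sub>R (a + b)"] by simp
  qed
  have "Cauchy (\<lambda>n. Q (m n))"
  proof (rule metric_CauchyI)
    fix e :: real assume e: "0 < e"
    obtain N where N: "1 / real (Suc N) < e\<^sup>2 / 4"
      using e nat_approx_posE[of "e\<^sup>2 / 4"] by auto
    have "dist (Q (m i)) (Q (m j)) < e" if "i \<ge> N" "j \<ge> N" for i j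
    proof -
      have "1 / real (Suc i) \<le> 1 / Suc N" "1 / real (Suc j) \<le> 1 / Suc N"
        using that by (simp_all add: frac_le)
      then have "(norm (Q (m i) - Q (m j)))\<^sup>2 < e\<^sup>2"
        using midpoint[of "m i" "m j"] m[of i] m[of j] N
        by argo
      then show ?thesis
        using e by (simp add: dist_norm power_less_imp_less_base)
    qed
    then show "\<exists>M. \<forall>i\<ge>M. \<forall>j\<ge>M. dist (Q (m i)) (Q (m j)) < e" by blast
  qed
  then obtain r where r: "(\<lambda>n. Q (m n)) \<longlonglongrightarrow> r"
    using Cauchy_convergent_iff convergent_def by blast
  have Re_eq: "Re (g z) = Re (cinner (Q z) r)" for z
  proof -
    define d where "d = Re (cinner r (Q z)) - Re (g z)"
    have "0 \<le> 2 * t * d + t\<^sup>2 * (norm (Q z))\<^sup>2" for t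
    proof -
      \<comment> \<open>\<open>J\<close> need not attain its infimum, so the first variation is
        taken at \<open>m n\<close>, with error \<open>1 / Suc n\<close>, and then passes to the
        limit.\<close>
      let ?h = "\<lambda>n. 2 * t * (Re (cinner (Q (m n)) (Q z)) - Re (g z)) + t\<^sup>2 * (norm (Q z))\<^sup>2"
      have le: "0 \<le> ?h n + 1 / real (Suc n)" for n
      proof -
        have "J (m n + t *\<^sub>R z) = J (m n) + ?h n"
          by (simp add: J_def Qs norm_add_sq g_add g_scaleR cinner_simps power_mult_distrib
              algebra_simps)
        then show ?thesis using I_le[of "m n + t *\<^sub>R z"] m[of n] by linarith
      qed
      have "(\<lambda>n. ?h n + 1 / real (Suc n)) \<longlonglongrightarrow> 2 * t * d + t\<^sup>2 * (norm (Q z))\<^sup>2 + 0"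
        unfolding d_def
        by (intro tendsto_intros tendsto_cinner r lim_1_over_n[THEN LIMSEQ_Suc])
      then have "0 \<le> 2 * t * d + t\<^sup>2 * (norm (Q z))\<^sup>2 + 0"
        by (rule LIMSEQ_le_const) (use le in blast)
      then show ?thesis by simp
    qed
    then have "d = 0" by (intro linear_coeff_zero[of "(norm (Q z))\<^sup>2"]) auto
    then show ?thesis by (simp add: d_def Re_cinner_commute)
  qed
  \<comment> \<open>Real parts at \<open>\<i> *\<^sub>C z\<close> supply the imaginary parts at
    \<open>z\<close>.\<close>
  have "g z = cinner (Q z) r" for z
    using Re_eq[of z] Re_eq[of "\<i> *\<^sub>C z"]
    by (simp add: complex_eq_iff g_scale Qs cinner_scaleC_left)
  with r show thesis by (rule that)
qed

section \<open>Adjoints and the orthogonal splitting along a kernel\<close>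

lemma cinner_cadjoint_right:
  fixes T :: "'a::complex_hilbert_space \<Rightarrow> 'a"
  assumes T: "bounded_clinear T"
  shows "cinner (T x) y = cinner x (cadjoint T y)"
proof -
  obtain K where K: "K > 0" "\<And>x. norm (T x) \<le> K * norm x"
    using bounded_clinear_bound[OF T] by blast
  have "\<exists>r. \<forall>x. cinner (T x) y = cinner x r" for y
  proof (rule riesz_on_range[OF bounded_clinear_id])
    show "cmod (cinner (T x) y) \<le> K * norm y * norm x" for x
      using cmod_cinner_le[of "T x" y] mult_right_mono[OF K(2)[of x] norm_ge_zero[of y]]
      by (simp add: mult_ac)
  qed (auto simp: bounded_clinearD[OF T] cinner_simps)
  then obtain S where S: "\<forall>x y. cinner (T x) y = cinner x (S y)" by metis
  moreover have "S' = S" if "\<forall>x y. cinner (T x) y = cinner x (S' y)" for S'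
  proof
    show "S' y = S y" for y
      by (rule cinner_ext) (metis that S)
  qed
  ultimately have "\<forall>x y. cinner (T x) y = cinner x (cadjoint T y)"
    unfolding cadjoint_def by (rule theI)
  then show ?thesis by simp
qed

lemma cinner_cadjoint_left:
  assumes "bounded_clinear T"
  shows "cinner (cadjoint T x) y = cinner x (T y)"
  using cinner_cadjoint_right[OF assms, of y x] by (metis cinner_commute)

lemma bounded_clinear_cadjoint:
  assumes T: "bounded_clinear T"
  shows "bounded_clinear (cadjoint T)"
proof -
  obtain K where K: "K > 0" "\<And>x. norm (T x) \<le> K * norm x"
    using bounded_clinear_bound[OF T] by blast
  note adj = cinner_cadjoint_right[OF T, symmetric]
  show ?thesis
  proof (rule bounded_clinearI)
    show "cadjoint T (x + y) = cadjoint T x + cadjoint T y" for x y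
      by (rule cinner_ext) (simp add: adj cinner_simps)
    show "cadjoint T (c *\<^sub>C x) = c *\<^sub>C cadjoint T x" for c x
      by (rule cinner_ext) (simp add: adj cinner_simps)
    show "norm (cadjoint T x) \<le> norm x * K" for x
    proof (cases "cadjoint T x = 0")
      case False
      have "(norm (cadjoint T x))\<^sup>2 = Re (cinner (cadjoint T x) (cadjoint T x))"
        by (simp add: cinner_self)
      also have "\<dots> = Re (cinner (T (cadjoint T x)) x)"
        by (simp add: adj)
      also have "\<dots> \<le> norm (T (cadjoint T x)) * norm x"
        by (rule Re_cinner_le)
      also have "\<dots> \<le> K * norm (cadjoint T x) * norm x"
        using K by (intro mult_right_mono) auto
      finally have "norm (cadjoint T x) * norm (cadjoint T x) \<le> norm (cadjoint T x) * (norm x * K)"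
        by (simp add: power2_eq_square mult_ac)
      then show ?thesis using False by simp
    qed (use K in simp)
  qed
qed

text \<open>\<open>c\<close> is the projection of \<open>x\<close> onto the closed range of
  \<open>cadjoint A\<close>, found by Riesz; \<open>x - c\<close> is orthogonal to that range, hence
  killed by \<open>A\<close>. The sequence \<open>m\<close> lets identities on the range pass to its
  closure.\<close>

lemma kernel_decomposition:
  fixes A :: "'a::complex_hilbert_space \<Rightarrow> 'a"
  assumes A: "bounded_clinear A"
  obtains c n m where "x = c + n" "A n = 0" "(\<lambda>k. cadjoint A (m k)) \<longlonglongrightarrow> c"
    "c \<in> orth_complement (null_space A)"
proof -
  note As = bounded_clinear_cadjoint[OF A]
  obtain c m where c: "(\<lambda>k. cadjoint A (m k)) \<longlonglongrightarrow> c"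
    "\<And>z. cinner (cadjoint A z) x = cinner (cadjoint A z) c"
  proof (rule riesz_on_range[OF As, of "\<lambda>z. cinner (cadjoint A z) x" "norm x"])
    show "cmod (cinner (cadjoint A z) x) \<le> norm x * norm (cadjoint A z)" for z
      using cmod_cinner_le[of "cadjoint A z" x] by (simp add: mult.commute)
  qed (auto simp: bounded_clinearD[OF As] cinner_simps)
  have "A x = A c"
    by (rule cinner_ext) (use c(2) in \<open>simp add: cinner_cadjoint_left[OF A]\<close>)
  then have "A (x - c) = 0" by (simp add: bounded_clinearD[OF A])
  moreover have "cinner c n = 0" if "A n = 0" for n
  proof -
    have "(\<lambda>k. cinner (cadjoint A (m k)) n) \<longlonglongrightarrow> cinner c n"
      by (intro tendsto_cinner c tendsto_const)
    then show ?thesis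
      using that by (simp add: cinner_cadjoint_left[OF A] LIMSEQ_const_iff)
  qed
  ultimately show thesis
    using that[of c "x - c" m] c(1) by (simp add: orth_complement_def null_space_def)
qed

section \<open>Positive operators and square roots\<close>

lemma positive_opD:
  assumes "positive_op P"
  shows "bounded_clinear P" "Re (cinner (P x) x) \<ge> 0" "Im (cinner (P x) x) = 0"
  using assms by (auto simp: positive_op_def complex_nonneg_Reals_iff)

text \<open>Polarization: the sesquilinear defect \<open>s\<close> vanishes on the diagonal, and
  evaluating it at \<open>x + y\<close> and \<open>x + \<i> *\<^sub>C y\<close> forces it to vanish
  everywhere.\<close>

lemma positive_op_selfadjoint:
  assumes P: "positive_op P"
  shows "cinner (P x) y = cinner x (P y)"
proof -
  define s where "s x y = cinner (P x) y - cinner x (P y)" for x y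
  note Ps = bounded_clinearD[OF positive_opD(1)[OF P]]
  have s0: "s x x = 0" for x
    using positive_opD(3)[OF P, of x] cinner_commute[of x "P x"]
    by (simp add: s_def complex_eq_iff)
  have "s x y + s y x = 0"
    using s0[of "x + y"] s0[of x] s0[of y] by (simp add: s_def Ps cinner_simps algebra_simps)
  moreover have "\<i> * s y x - \<i> * s x y = 0"
    using s0[of "x + \<i> *\<^sub>C y"] s0[of x] s0[of y]
    by (simp add: s_def Ps cinner_simps algebra_simps)
  ultimately have "s x y = 0"
    by (simp add: add_eq_0_iff)
  then show ?thesis by (simp add: s_def)
qed

lemma positive_opI:
  assumes "bounded_clinear P" "\<And>x y. cinner (P x) y = cinner x (P y)"
    "\<And>x. Re (cinner (P x) x) \<ge> 0"
  shows "positive_op P"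
proof -
  have "Im (cinner (P x) x) = 0" for x
    using assms(2)[of x x] cinner_commute[of x "P x"] by (simp add: complex_eq_iff)
  with assms show ?thesis by (auto simp: positive_op_def complex_nonneg_Reals_iff)
qed

text \<open>A quantitative form of \<open>P P \<le> K P\<close>, obtained without square roots: a
  vector with small quadratic form has small image.\<close>

lemma positive_op_norm_sq_le:
  assumes P: "positive_op P" and K: "K > 0" "\<And>x. norm (P x) \<le> K * norm x"
  shows "(norm (P x))\<^sup>2 \<le> K * Re (cinner (P x) x)"
proof -
  note Ps = bounded_clinearD[OF positive_opD(1)[OF P]]
  \<comment> \<open>This \<open>t\<close> minimises the upper bound for the form at
    \<open>x - t *\<^sub>R P x\<close> derived below.\<close>
  define t where "t = 1 / K"
  let ?q = "Re (cinner (P (P x)) (P x))"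
  have "?q \<le> norm (P (P x)) * norm (P x)"
    by (rule Re_cinner_le)
  also have "\<dots> \<le> K * norm (P x) * norm (P x)"
    by (intro mult_right_mono K) auto
  finally have q: "?q \<le> K * (norm (P x))\<^sup>2" by (simp add: power2_eq_square)
  have "0 \<le> Re (cinner (P (x - t *\<^sub>R P x)) (x - t *\<^sub>R P x))"
    by (rule positive_opD(2)[OF P])
  also have "\<dots> = Re (cinner (P x) x) - 2 * t * (norm (P x))\<^sup>2 + t\<^sup>2 * ?q"
    by (simp add: Ps cinner_simps positive_op_selfadjoint[OF P, of "P x" x] cinner_self
        algebra_simps power2_eq_square)
  also have "\<dots> \<le> Re (cinner (P x) x) - 2 * t * (norm (P x))\<^sup>2 + t\<^sup>2 * (K * (norm (P x))\<^sup>2)"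
    using q by (simp add: mult_left_mono)
  also have "t\<^sup>2 * (K * (norm (P x))\<^sup>2) = t * (norm (P x))\<^sup>2"
    using K by (simp add: t_def power2_eq_square)
  finally have "t * (norm (P x))\<^sup>2 \<le> Re (cinner (P x) x)" by simp
  then show ?thesis
    using K by (simp add: t_def field_simps)
qed

lemma positive_op_eq_zero:
  assumes P: "positive_op P" and "Re (cinner (P x) x) = 0"
  shows "P x = 0"
proof -
  obtain K where K: "K > 0" "\<And>x. norm (P x) \<le> K * norm x"
    using bounded_clinear_bound[OF positive_opD(1)[OF P]] by blast
  show ?thesis
    using positive_op_norm_sq_le[OF P K, of x] assms(2) by simp
qed

section \<open>Square roots by iteration\<close>

fun sqrt_iter :: "('a::complex_inner \<Rightarrow> 'a) \<Rightarrow> nat \<Rightarrow> 'a \<Rightarrow> 'a" where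
  "sqrt_iter A 0 x = 0"
| "sqrt_iter A (Suc n) x = (1/2) *\<^sub>R (x - A x + sqrt_iter A n (sqrt_iter A n x))"

text \<open>The scalar iteration for \<open>A = 0\<close>; its increments dominate those of the operator
  iteration.\<close>

fun sqrt_major :: "nat \<Rightarrow> real" where
  "sqrt_major 0 = 0"
| "sqrt_major (Suc n) = (1 + (sqrt_major n)\<^sup>2) / 2"

lemma sqrt_major_bounds: "0 \<le> sqrt_major n \<and> sqrt_major n \<le> 1"
  by (induction n) (auto simp: power_le_one)

lemma sqrt_major_mono: "sqrt_major n \<le> sqrt_major (Suc n)"
  using sum_squares_ge_zero[of "sqrt_major n - 1" 0]
  by (simp add: power2_eq_square algebra_simps)

lemma sqrt_major_convergent: "convergent sqrt_major"
proof (rule Bseq_mono_convergent)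
  show "Bseq sqrt_major"
    using sqrt_major_bounds by (intro BseqI'[of _ 1]) auto
  show "\<forall>m n. m \<le> n \<longrightarrow> sqrt_major m \<le> sqrt_major n"
    using lift_Suc_mono_le[of sqrt_major] sqrt_major_mono by blast
qed

lemma bounded_clinear_sqrt_iter:
  assumes A: "bounded_clinear A"
  shows "bounded_clinear (sqrt_iter A n)"
proof (induction n)
  case 0
  show ?case using bounded_clinear_diff[OF A A] by simp
next
  case (Suc n)
  have "sqrt_iter A (Suc n) = (\<lambda>x. (1/2) *\<^sub>R (x - A x + sqrt_iter A n (sqrt_iter A n x)))"
    by (rule ext) (rule sqrt_iter.simps)
  moreover have "bounded_clinear \<dots>"
    by (rule bounded_clinear_scaleR[OF bounded_clinear_add[OF
          bounded_clinear_diff[OF bounded_clinear_id A]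
          bounded_clinear_compose[OF Suc.IH Suc.IH]]])
  ultimately show ?case by (simp only:)
qed

text \<open>The iterates are polynomials in \<open>A\<close>. The property survives the limit and is
  what makes the square root unique.\<close>

lemma sqrt_iter_commute:
  assumes S: "bounded_clinear S" "\<And>x. S (A x) = A (S x)"
  shows "S (sqrt_iter A n x) = sqrt_iter A n (S x)"
  by (induction n arbitrary: x) (simp_all add: bounded_clinearD[OF S(1)] S(2))

lemma sqrt_iter_selfadjoint:
  assumes A: "positive_op A"
  shows "cinner (sqrt_iter A n x) y = cinner x (sqrt_iter A n y)"
  by (induction n arbitrary: x y) (simp_all add: cinner_simps positive_op_selfadjoint[OF A])

context
  fixes A :: "'a::complex_hilbert_space \<Rightarrow> 'a"
  assumes A: "positive_op A" and A_le: "\<And>x. norm (A x) \<le> norm x"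
begin

text \<open>Expanding the square, \<open>(norm (A x))^2\<close> is absorbed by one of the two copies
  of the nonnegative form of \<open>A\<close>. This makes \<open>A = 0\<close> the worst case of the
  iteration.\<close>

lemma norm_id_minus_le: "norm (x - A x) \<le> norm x"
proof (rule power2_le_imp_le)
  show "(norm (x - A x))\<^sup>2 \<le> (norm x)\<^sup>2"
    using positive_op_norm_sq_le[OF A, of 1 x] A_le positive_opD(2)[OF A, of x]
    by (simp add: norm_diff_sq Re_cinner_commute[of x])
qed simp

lemma norm_sqrt_iter_le: "norm (sqrt_iter A n x) \<le> sqrt_major n * norm x"
proof (induction n arbitrary: x)
  case (Suc n)
  let ?Y = "sqrt_iter A n"
  have "norm (?Y (?Y x)) \<le> sqrt_major n * norm (?Y x)" by (rule Suc.IH)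
  also have "\<dots> \<le> sqrt_major n * (sqrt_major n * norm x)"
    by (intro mult_left_mono Suc.IH) (simp add: sqrt_major_bounds)
  finally have "norm (x - A x + ?Y (?Y x)) \<le> norm x + (sqrt_major n)\<^sup>2 * norm x"
    using norm_triangle_ineq[of "x - A x" "?Y (?Y x)"] norm_id_minus_le[of x]
    by (simp add: power2_eq_square)
  then show ?case by (simp add: distrib_right)
qed simp

text \<open>Induction through \<open>Z Z - Y Y = Z (Z - Y) + (Z - Y) Y\<close> for consecutive
  iterates; the scalar iteration splits in the same way.\<close>

lemma norm_sqrt_iter_diff_le:
  "norm (sqrt_iter A (Suc n) x - sqrt_iter A n x) \<le> (sqrt_major (Suc n) - sqrt_major n) * norm x"
proof (induction n arbitrary: x)
  case 0
  show ?case using norm_id_minus_le[of x] by simp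
next
  case (Suc n)
  define Y Z where "Y = sqrt_iter A n" and "Z = sqrt_iter A (Suc n)"
  define y z where "y = sqrt_major n" and "z = sqrt_major (Suc n)"
  note defs = Y_def Z_def y_def z_def
  have Z: "Z (u - v) = Z u - Z v" for u v
    unfolding Z_def by (rule bounded_clinearD[OF bounded_clinear_sqrt_iter[OF positive_opD(1)[OF A]]])
  have IH: "norm (Z u - Y u) \<le> (z - y) * norm u" for u
    unfolding defs by (rule Suc.IH)
  have z: "0 \<le> z" and yz: "0 \<le> z - y"
    using sqrt_major_bounds[of "Suc n"] sqrt_major_mono[of n] by (simp_all add: y_def z_def)
  have "norm (Z (Z x - Y x)) \<le> z * norm (Z x - Y x)"
    unfolding defs by (rule norm_sqrt_iter_le)
  also have "\<dots> \<le> z * ((z - y) * norm x)"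
    by (intro mult_left_mono IH z)
  finally have 1: "norm (Z (Z x - Y x)) \<le> z * ((z - y) * norm x)" .
  have "norm (Z (Y x) - Y (Y x)) \<le> (z - y) * norm (Y x)"
    by (rule IH)
  also have "norm (Y x) \<le> y * norm x"
    unfolding defs by (rule norm_sqrt_iter_le)
  finally have 2: "norm (Z (Y x) - Y (Y x)) \<le> (z - y) * (y * norm x)"
    using yz by (simp add: mult_left_mono)
  have "sqrt_iter A (Suc (Suc n)) x - Z x
      = (1/2) *\<^sub>R (x - A x + Z (Z x)) - (1/2) *\<^sub>R (x - A x + Y (Y x))"
    by (rule arg_cong2[where f = "(-)"]) (simp_all only: defs sqrt_iter.simps(2)[of A "Suc n" x]
        sqrt_iter.simps(2)[of A n x])
  also have "\<dots> = (1/2) *\<^sub>R (Z (Z x - Y x) + (Z (Y x) - Y (Y x)))"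
    by (simp add: Z scaleR_diff_right[symmetric])
  finally have "norm (sqrt_iter A (Suc (Suc n)) x - Z x)
      \<le> (norm (Z (Z x - Y x)) + norm (Z (Y x) - Y (Y x))) / 2"
    using norm_triangle_ineq[of "Z (Z x - Y x)" "Z (Y x) - Y (Y x)"] by simp
  also have "\<dots> \<le> (z * ((z - y) * norm x) + (z - y) * (y * norm x)) / 2"
    using 1 2 by simp
  also have "\<dots> = ((1 + z\<^sup>2) / 2 - (1 + y\<^sup>2) / 2) * norm x"
    by (simp add: power2_eq_square field_simps)
  also have "(1 + z\<^sup>2) / 2 - (1 + y\<^sup>2) / 2 = sqrt_major (Suc (Suc n)) - z"
    by (simp add: y_def z_def)
  finally show ?case by (simp only: defs)
qed

text \<open>The increments are dominated by a convergent telescoping series, and the iterates are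
  their partial sums because the iteration starts at zero.\<close>

lemma sqrt_iter_convergent: "convergent (\<lambda>n. sqrt_iter A n x)"
proof -
  obtain l where "sqrt_major \<longlonglongrightarrow> l"
    using sqrt_major_convergent unfolding convergent_def by blast
  then have "summable (\<lambda>n. (sqrt_major (Suc n) - sqrt_major n) * norm x)"
    by (rule summable_mult2[OF telescope_summable])
  then have "summable (\<lambda>n. sqrt_iter A (Suc n) x - sqrt_iter A n x)"
    by (rule summable_comparison_test'[where N = 0]) (rule norm_sqrt_iter_diff_le)
  then have "convergent (\<lambda>n. \<Sum>k<n. sqrt_iter A (Suc k) x - sqrt_iter A k x)"
    by (simp only: summable_iff_convergent)
  then show ?thesis
    by (simp only: sum_lessThan_telescope[of "\<lambda>k. sqrt_iter A k x"] sqrt_iter.simps(1) diff_zero)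
qed

text \<open>The commutation clause is carried along for the uniqueness argument in
  \<open>sqrt_op_props\<close>.\<close>

lemma contraction_sqrt_exists:
  "\<exists>R. positive_op R \<and> R \<circ> R = A \<and>
     (\<forall>S. bounded_clinear S \<longrightarrow> (\<forall>x. S (A x) = A (S x)) \<longrightarrow> (\<forall>x. S (R x) = R (S x)))"
proof -
  obtain Y where Y: "\<And>x. (\<lambda>n. sqrt_iter A n x) \<longlonglongrightarrow> Y x"
    using sqrt_iter_convergent unfolding convergent_def by metis
  note iter = bounded_clinear_sqrt_iter[OF positive_opD(1)[OF A]]
  have norm_iter: "norm (sqrt_iter A n x) \<le> norm x" for n x
    using norm_sqrt_iter_le[of n x] sqrt_major_bounds[of n]
      mult_right_mono[of "sqrt_major n" 1 "norm x"] by simp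
  have norm_Y: "norm (Y x) \<le> norm x" for x
    using LIMSEQ_le_const2[OF tendsto_norm[OF Y]] norm_iter by blast
  have Y_add: "Y (x + y) = Y x + Y y" for x y
    using LIMSEQ_unique[OF Y[of "x + y"]] tendsto_add[OF Y[of x] Y[of y]]
    by (simp add: bounded_clinearD[OF iter])
  have Y_scale: "Y (c *\<^sub>C x) = c *\<^sub>C Y x" for c x
    using LIMSEQ_unique[OF Y[of "c *\<^sub>C x"]] LIMSEQ_scaleC[OF Y[of x], of c]
    by (simp add: bounded_clinearD[OF iter])
  have bY: "bounded_clinear Y"
    by (rule bounded_clinearI[of _ 1]) (simp_all add: Y_add Y_scale norm_Y)
  have Y_sa: "cinner (Y x) y = cinner x (Y y)" for x y
    using LIMSEQ_unique[OF tendsto_cinner[OF Y[of x] tendsto_const[of y]]]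
      tendsto_cinner[OF tendsto_const[of x] Y[of y]]
    by (simp add: sqrt_iter_selfadjoint[OF A])
  \<comment> \<open>Pointwise limits may be composed here because all iterates are
    contractions.\<close>
  have YY: "(\<lambda>n. sqrt_iter A n (sqrt_iter A n x)) \<longlonglongrightarrow> Y (Y x)" for x
  proof -
    have "(\<lambda>n. sqrt_iter A n (sqrt_iter A n x - Y x)) \<longlonglongrightarrow> 0"
    proof (rule tendsto_0_le[where K = 1])
      show "(\<lambda>n. sqrt_iter A n x - Y x) \<longlonglongrightarrow> 0"
        using Y[of x] by (rule LIM_zero)
    qed (simp add: norm_iter)
    from tendsto_add[OF this Y[of "Y x"]] show ?thesis
      by (simp add: bounded_clinearD[OF iter])
  qed
  have fixpoint: "Y x = (1/2) *\<^sub>R (x - A x + Y (Y x))" for x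
  proof (rule LIMSEQ_unique[OF LIMSEQ_Suc[OF Y[of x]]])
    show "(\<lambda>n. sqrt_iter A (Suc n) x) \<longlonglongrightarrow> (1/2) *\<^sub>R (x - A x + Y (Y x))"
      unfolding sqrt_iter.simps by (intro tendsto_intros YY)
  qed
  define R where "R x = x - Y x" for x
  have "positive_op R"
  proof (rule positive_opI)
    show "bounded_clinear R"
      unfolding R_def[abs_def] by (intro bounded_clinear_diff bounded_clinear_id bY)
    show "cinner (R x) y = cinner x (R y)" for x y
      by (simp add: R_def cinner_simps Y_sa)
    show "0 \<le> Re (cinner (R x) x)" for x
      using Re_cinner_le[of "Y x" x] mult_right_mono[OF norm_Y[of x] norm_ge_zero[of x]]
      by (simp add: R_def cinner_simps cinner_self power2_eq_square)
  qed
  moreover have "R (R x) = A x" for x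
  proof -
    \<comment> \<open>The fixed point equation \<open>2 Y = 1 - A + Y Y\<close> rearranges to
      \<open>(1 - Y)^2 = A\<close>.\<close>
    have "2 *\<^sub>R Y x = x - A x + Y (Y x)"
      by (subst fixpoint) simp
    then show ?thesis
      by (simp add: R_def bounded_clinearD[OF bY] scaleR_2 algebra_simps)
  qed
  moreover have "S (R x) = R (S x)" if S: "bounded_clinear S" "\<And>x. S (A x) = A (S x)" for S x
  proof -
    have "(\<lambda>n. S (sqrt_iter A n x)) \<longlonglongrightarrow> S (Y x)"
      by (rule bounded_linear.tendsto[OF bounded_clinearD(1)[OF S(1)] Y])
    then have "S (Y x) = Y (S x)"
      using LIMSEQ_unique[OF _ Y[of "S x"]] by (simp add: sqrt_iter_commute[where S = S and A = A, OF S])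
    then show ?thesis by (simp add: R_def bounded_clinearD[OF S(1)])
  qed
  ultimately show ?thesis by (intro exI[of _ R]) (auto simp: fun_eq_iff)
qed

end

lemma positive_op_scaleR:
  assumes A: "positive_op A" and "r \<ge> 0"
  shows "positive_op (\<lambda>x. r *\<^sub>R A x)"
  using assms by (auto simp: positive_op_def complex_nonneg_Reals_iff cinner_simps
      intro: bounded_clinear_scaleR)

text \<open>Rescaling: take the root of the contraction \<open>A / K\<close> and multiply it by
  \<open>sqrt K\<close>.\<close>

lemma positive_sqrt_exists:
  assumes A: "positive_op A"
  shows "\<exists>R. positive_op R \<and> R \<circ> R = A \<and>
     (\<forall>S. bounded_clinear S \<longrightarrow> (\<forall>x. S (A x) = A (S x)) \<longrightarrow> (\<forall>x. S (R x) = R (S x)))"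
proof -
  obtain K where K: "K > 0" "\<And>x. norm (A x) \<le> K * norm x"
    using bounded_clinear_bound[OF positive_opD(1)[OF A]] by blast
  define A' where "A' x = (1 / K) *\<^sub>R A x" for x
  have "positive_op A'"
    unfolding A'_def[abs_def] using A K by (intro positive_op_scaleR) auto
  moreover have "norm (A' x) \<le> norm x" for x
    using K by (simp add: A'_def field_simps)
  ultimately obtain R where R: "positive_op R" "R \<circ> R = A'"
    and comm: "\<And>S x. bounded_clinear S \<Longrightarrow> (\<And>x. S (A' x) = A' (S x)) \<Longrightarrow> S (R x) = R (S x)"
    using contraction_sqrt_exists[of A'] by blast
  define R' where "R' x = sqrt K *\<^sub>R R x" for x
  have "positive_op R'"
    unfolding R'_def[abs_def] using R K by (intro positive_op_scaleR) auto
  moreover have "R' (R' x) = A x" for x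
    using K fun_cong[OF R(2), of x]
    by (simp add: R'_def bounded_clinearD[OF positive_opD(1)[OF R(1)]] A'_def)
  moreover have "S (R' x) = R' (S x)" if S: "bounded_clinear S" "\<And>x. S (A x) = A (S x)" for S x
    using comm[OF S(1)] S(2) by (simp add: R'_def A'_def bounded_clinearD[OF S(1)])
  ultimately show ?thesis by (intro exI[of _ R']) (auto simp: fun_eq_iff)
qed

text \<open>For uniqueness, another root \<open>S\<close> commutes with \<open>A = S S\<close>,
  hence with \<open>R\<close>. Then \<open>R + S\<close> kills \<open>y = R x - S x\<close>,
  positivity makes \<open>R y\<close> and \<open>S y\<close> both zero, and
  \<open>cinner y y = cinner x (R y - S y)\<close> vanishes.\<close>

lemma sqrt_op_props:
  assumes A: "positive_op A"
  shows "positive_op (sqrt_op A) \<and> sqrt_op A \<circ> sqrt_op A = A"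
proof -
  obtain R where R: "positive_op R" "R \<circ> R = A"
    and comm: "\<And>S x. bounded_clinear S \<Longrightarrow> (\<And>x. S (A x) = A (S x)) \<Longrightarrow> S (R x) = R (S x)"
    using positive_sqrt_exists[OF A] by blast
  have "S = R" if S: "positive_op S" "S \<circ> S = A" for S
  proof
    fix x
    note Rb = bounded_clinearD[OF positive_opD(1)[OF R(1)]]
    note Sb = bounded_clinearD[OF positive_opD(1)[OF S(1)]]
    have RR: "R (R z) = A z" and SS: "S (S z) = A z" for z
      using R(2) S(2) by (auto simp: fun_eq_iff)
    have SR: "S (R z) = R (S z)" for z
      by (rule comm[OF positive_opD(1)[OF S(1)]]) (simp add: SS[symmetric])
    define y where "y = R x - S x"
    have "R y + S y = 0"
      by (simp add: y_def Rb Sb RR SS SR)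
    then have "Re (cinner (R y) y) + Re (cinner (S y) y) = 0"
      by (metis cinner_add_left cinner_zero_left plus_complex.sel(1) zero_complex.sel(1))
    then have "Re (cinner (R y) y) = 0" "Re (cinner (S y) y) = 0"
      using positive_opD(2)[OF R(1), of y] positive_opD(2)[OF S(1), of y] by linarith+
    then have "R y = 0" "S y = 0"
      using positive_op_eq_zero R(1) S(1) by blast+
    then have "cinner x (R y - S y) = 0" by simp
    then have "cinner y y = 0"
      using positive_op_selfadjoint[OF R(1)] positive_op_selfadjoint[OF S(1)]
      by (simp add: y_def cinner_diff_left cinner_diff_right Rb Sb SR)
    then show "S x = R x"
      by (simp add: cinner_eq_zero_iff y_def)
  qed
  with R have "\<exists>!R. positive_op R \<and> R \<circ> R = A" by blast
  then show ?thesis unfolding sqrt_op_def by (rule theI')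
qed

section \<open>Polar decomposition\<close>

lemma norm_of_gram_eq:
  assumes T: "bounded_clinear T" and P: "positive_op P" "P \<circ> P = cadjoint T \<circ> T"
  shows "norm (P x) = norm (T x)"
proof -
  have "cinner (P x) (P x) = cinner (P (P x)) x"
    by (simp add: positive_op_selfadjoint[OF P(1)])
  also have "P (P x) = cadjoint T (T x)"
    using P(2) by (metis comp_apply)
  also have "cinner (cadjoint T (T x)) x = cinner (T x) (T x)"
    by (rule cinner_cadjoint_left[OF T])
  finally have "(norm (P x))\<^sup>2 = (norm (T x))\<^sup>2"
    by (simp add: cinner_self flip: of_real_power)
  then show ?thesis by simp
qed

lemma abs_op_props:
  assumes T: "bounded_clinear T"
  shows "positive_op (abs_op T) \<and> (\<forall>x. norm (abs_op T x) = norm (T x))"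
proof -
  note adj = cinner_cadjoint_left[OF T] cinner_cadjoint_right[OF T, symmetric]
  have "positive_op (cadjoint T \<circ> T)"
  proof (rule positive_opI)
    show "bounded_clinear (cadjoint T \<circ> T)"
      by (intro bounded_clinear_comp bounded_clinear_cadjoint T)
  qed (simp_all add: adj cinner_self)
  then have "positive_op (abs_op T)" "abs_op T \<circ> abs_op T = cadjoint T \<circ> T"
    unfolding abs_op_def using sqrt_op_props by blast+
  with norm_of_gram_eq[OF T] show ?thesis by blast
qed

lemma cadjoint_positive_op:
  assumes "positive_op P"
  shows "cadjoint P = P"
proof
  show "cadjoint P x = P x" for x
    by (rule cinner_ext) (metis positive_op_selfadjoint[OF assms]
        cinner_cadjoint_right[OF positive_opD(1)[OF assms]])
qed

text \<open>The operator \<open>W\<close> is the adjoint of the partial isometry: \<open>W y\<close> represents the functional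
  \<open>P z \<mapsto> \<langle>T z, y\<rangle>\<close> on the closure of the range of \<open>P\<close>.\<close>

lemma polar_coisometry:
  fixes T :: "'a::complex_hilbert_space \<Rightarrow> 'a"
  assumes T: "bounded_clinear T" and P: "bounded_clinear P"
    and norm_eq: "\<And>x. norm (P x) = norm (T x)"
  obtains W where "bounded_clinear W" "\<And>z y. cinner (T z) y = cinner (P z) (W y)"
    "\<And>y. \<exists>m. (\<lambda>n. P (m n)) \<longlonglongrightarrow> W y"
proof -
  note Ts = bounded_clinearD[OF T] and Ps = bounded_clinearD[OF P]
  have "\<exists>r. (\<exists>m. (\<lambda>n. P (m n)) \<longlonglongrightarrow> r) \<and> (\<forall>z. cinner (T z) y = cinner (P z) r)" for y
  proof (rule riesz_on_range[OF P])
    \<comment> \<open>Equality of norms bounds the functional by \<open>norm (P z)\<close>, so its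
      value depends on \<open>P z\<close> alone.\<close>
    show "cmod (cinner (T z) y) \<le> norm y * norm (P z)" for z
      using cmod_cinner_le[of "T z" y] by (simp add: norm_eq mult.commute)
  qed (auto simp: Ts cinner_simps)
  then obtain W where W: "\<And>z y. cinner (T z) y = cinner (P z) (W y)"
    and W_closure: "\<And>y. \<exists>m. (\<lambda>n. P (m n)) \<longlonglongrightarrow> W y" by metis
  \<comment> \<open>The difference lies in the closure of the range of \<open>P\<close> and is
    orthogonal to that range.\<close>
  have unique: "r = r'" if "(\<lambda>n. P (m n)) \<longlonglongrightarrow> r" "(\<lambda>n. P (m' n)) \<longlonglongrightarrow> r'"
    "\<And>z. cinner (P z) r = cinner (P z) r'" for m m' r r'
  proof -
    have "(\<lambda>n. cinner (P (m n - m' n)) (r - r')) \<longlonglongrightarrow> cinner (r - r') (r - r')"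
      unfolding Ps by (intro tendsto_cinner tendsto_diff that tendsto_const)
    moreover have "cinner (P z) (r - r') = 0" for z
      using that(3) by (simp add: cinner_diff_right)
    ultimately have "cinner (r - r') (r - r') = 0"
      by (simp add: LIMSEQ_const_iff)
    then show ?thesis by (simp add: cinner_eq_zero_iff)
  qed
  have W_add: "W (x + y) = W x + W y" for x y
  proof -
    obtain m where m: "(\<lambda>n. P (m n)) \<longlonglongrightarrow> W (x + y)" using W_closure by blast
    obtain a where a: "(\<lambda>n. P (a n)) \<longlonglongrightarrow> W x" using W_closure by blast
    obtain b where b: "(\<lambda>n. P (b n)) \<longlonglongrightarrow> W y" using W_closure by blast
    have "(\<lambda>n. P (a n + b n)) \<longlonglongrightarrow> W x + W y"
      unfolding Ps by (intro tendsto_add a b)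
    from unique[OF m this] show ?thesis
      by (simp add: cinner_add_right W[symmetric])
  qed
  have W_scale: "W (c *\<^sub>C x) = c *\<^sub>C W x" for c x
  proof -
    obtain m where m: "(\<lambda>n. P (m n)) \<longlonglongrightarrow> W (c *\<^sub>C x)" using W_closure by blast
    obtain a where a: "(\<lambda>n. P (a n)) \<longlonglongrightarrow> W x" using W_closure by blast
    have "(\<lambda>n. P (c *\<^sub>C a n)) \<longlonglongrightarrow> c *\<^sub>C W x"
      unfolding Ps by (intro LIMSEQ_scaleC a)
    from unique[OF m this] show ?thesis
      by (simp add: cinner_scaleC_right W[symmetric])
  qed
  \<comment> \<open>Cauchy-Schwarz is applied to \<open>T (m n)\<close> and \<open>y\<close> along a
    sequence with \<open>P (m n)\<close> tending to \<open>W y\<close>; the factor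
    \<open>norm (W y)\<close> then cancels.\<close>
  have W_norm: "norm (W y) \<le> norm y" for y
  proof -
    obtain m where m: "(\<lambda>n. P (m n)) \<longlonglongrightarrow> W y" using W_closure by blast
    have "Re (cinner (W y) (W y)) \<le> norm (W y) * norm y"
    proof (rule LIMSEQ_le)
      show "(\<lambda>n. Re (cinner (P (m n)) (W y))) \<longlonglongrightarrow> Re (cinner (W y) (W y))"
        by (intro tendsto_Re tendsto_cinner m tendsto_const)
      show "(\<lambda>n. norm (P (m n)) * norm y) \<longlonglongrightarrow> norm (W y) * norm y"
        by (intro tendsto_mult tendsto_norm m tendsto_const)
      show "\<exists>N. \<forall>n\<ge>N. Re (cinner (P (m n)) (W y)) \<le> norm (P (m n)) * norm y"
        using Re_cinner_le[of "T (m _)" y] by (simp add: W[symmetric] norm_eq)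
    qed
    then have "norm (W y) * norm (W y) \<le> norm (W y) * norm y"
      by (simp add: cinner_self power2_eq_square)
    then show ?thesis by (cases "W y = 0") simp_all
  qed
  have "bounded_clinear W"
    by (rule bounded_clinearI[of _ 1]) (simp_all add: W_add W_scale W_norm)
  then show thesis using W W_closure by (rule that)
qed

text \<open>\<open>V\<close> is the adjoint of \<open>W\<close>. It sends \<open>P z\<close> to
  \<open>T z\<close>, is isometric on the closed range of \<open>P\<close> by continuity, and
  vanishes on the kernel.\<close>

lemma polar_exists:
  fixes T :: "'a::complex_hilbert_space \<Rightarrow> 'a"
  assumes T: "bounded_clinear T"
  shows "\<exists>V. partial_isometry V \<and> null_space V = null_space T \<and> T = V \<circ> abs_op T"
proof -
  define P where "P = abs_op T"
  have P: "positive_op P" and norm_eq: "norm (P x) = norm (T x)" for x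
    using abs_op_props[OF T] by (auto simp: P_def)
  note Pb = positive_opD(1)[OF P]
  obtain W where W: "bounded_clinear W" "\<And>z y. cinner (T z) y = cinner (P z) (W y)"
    and W_closure: "\<And>y. \<exists>m. (\<lambda>n. P (m n)) \<longlonglongrightarrow> W y"
    using polar_coisometry[OF T Pb norm_eq] by metis
  define V where "V = cadjoint W"
  have V: "bounded_clinear V"
    unfolding V_def by (rule bounded_clinear_cadjoint[OF W(1)])
  have VP: "V (P z) = T z" for z
  proof -
    have "cinner (T z - V (P z)) y = 0" for y
      by (simp add: cinner_diff_left V_def cinner_cadjoint_left[OF W(1)] W(2))
    then show ?thesis
      using cinner_eq_zero_iff[of "T z - V (P z)"] by simp
  qed
  \<comment> \<open>\<open>W\<close> maps into the closed range of \<open>P\<close>, which is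
    orthogonal to the kernel of the self-adjoint \<open>P\<close>.\<close>
  have V_zero: "V x = 0" if "P x = 0" for x
  proof -
    obtain m where m: "(\<lambda>n. P (m n)) \<longlonglongrightarrow> W (V x)" using W_closure by blast
    have "(\<lambda>n. cinner x (P (m n))) \<longlonglongrightarrow> cinner x (W (V x))"
      by (intro tendsto_cinner m tendsto_const)
    then have "cinner x (W (V x)) = 0"
      using that by (simp add: positive_op_selfadjoint[OF P, symmetric] LIMSEQ_const_iff)
    then have "cinner (V x) (V x) = 0"
      by (simp add: V_def cinner_cadjoint_left[OF W(1)])
    then show ?thesis by (simp add: cinner_eq_zero_iff)
  qed
  have decomp: "\<exists>c n. x = c + n \<and> P n = 0 \<and> V x = V c \<and> norm (V c) = norm c \<and>
      c \<in> orth_complement (null_space P)" for x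
  proof -
    obtain c n m where c: "x = c + n" "P n = 0" "(\<lambda>k. P (m k)) \<longlonglongrightarrow> c"
      "c \<in> orth_complement (null_space P)"
      using kernel_decomposition[OF Pb, of x] unfolding cadjoint_positive_op[OF P] by metis
    have "(\<lambda>k. norm (V (P (m k)))) \<longlonglongrightarrow> norm (V c)"
      by (intro tendsto_norm bounded_linear.tendsto[OF bounded_clinearD(1)[OF V]] c(3))
    then have "norm (V c) = norm c"
      using LIMSEQ_unique[OF _ tendsto_norm[OF c(3)]] by (simp add: VP norm_eq)
    moreover have "V x = V c"
      using V_zero[OF c(2)] by (simp add: c(1) bounded_clinearD[OF V])
    ultimately show ?thesis using c by blast
  qed
  have null_V: "null_space V = null_space P"
  proof (intro set_eqI iffI)
    fix x assume "x \<in> null_space V"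
    moreover obtain c n where "x = c + n" "P n = 0" "V x = V c" "norm (V c) = norm c"
      using decomp by blast
    ultimately show "x \<in> null_space P" by (simp add: null_space_def)
  qed (simp add: null_space_def V_zero)
  have "norm (V x) = norm x" if x: "x \<in> orth_complement (null_space V)" for x
  proof -
    obtain c n where c: "x = c + n" "P n = 0" "V x = V c" "norm (V c) = norm c"
      "c \<in> orth_complement (null_space P)"
      using decomp by blast
    have "n \<in> null_space P" using c(2) by (simp add: null_space_def)
    \<comment> \<open>Orthogonality of both \<open>x\<close> and \<open>c\<close> to
      \<open>n\<close> leaves \<open>cinner n n = 0\<close>.\<close>
    then have "cinner x n = 0" "cinner c n = 0"
      using x c(5) unfolding null_V orth_complement_def by blast+
    then have "n = 0" by (simp add: c(1) cinner_add_left cinner_eq_zero_iff)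
    with c show ?thesis by simp
  qed
  with V have "partial_isometry V" by (simp add: partial_isometry_def)
  moreover have "null_space P = null_space T"
    unfolding null_space_def by (metis norm_eq norm_eq_zero)
  ultimately show ?thesis
    using null_V VP by (intro exI[of _ V]) (auto simp: P_def fun_eq_iff)
qed

text \<open>The maps agree on the range of \<open>P\<close>, by continuity on its closure, and both
  vanish on the complementary kernel.\<close>

lemma polar_unique:
  assumes P: "positive_op P"
    and V: "bounded_clinear V" "null_space V = null_space P"
    and V': "bounded_clinear V'" "null_space V' = null_space P"
    and eq: "V \<circ> P = V' \<circ> P"
  shows "V = V'"
proof
  fix x
  obtain c n m where c: "x = c + n" "P n = 0" "(\<lambda>k. P (m k)) \<longlonglongrightarrow> c"
    using kernel_decomposition[OF positive_opD(1)[OF P], of x]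
    unfolding cadjoint_positive_op[OF P] by metis
  have "V (P z) = V' (P z)" for z using eq by (metis comp_apply)
  then have "V c = V' c"
    using LIMSEQ_unique[OF bounded_linear.tendsto[OF bounded_clinearD(1)[OF V(1)] c(3)]]
      bounded_linear.tendsto[OF bounded_clinearD(1)[OF V'(1)] c(3)] by simp
  moreover have "V n = 0" "V' n = 0"
    using c(2) V(2) V'(2) by (auto simp: null_space_def)
  ultimately show "V x = V' x"
    by (simp add: c(1) bounded_clinearD[OF V(1)] bounded_clinearD[OF V'(1)])
qed

lemma polar_isometry_props:
  assumes T: "bounded_clinear T"
  shows "partial_isometry (polar_isometry T) \<and> null_space (polar_isometry T) = null_space T
    \<and> T = polar_isometry T \<circ> abs_op T"
proof -
  have "null_space (abs_op T) = null_space T"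
    unfolding null_space_def using abs_op_props[OF T] by (metis norm_eq_zero)
  then have "\<exists>!V. partial_isometry V \<and> null_space V = null_space T \<and> T = V \<circ> abs_op T"
    using polar_exists[OF T] polar_unique[of "abs_op T"] abs_op_props[OF T]
    unfolding partial_isometry_def by (metis (no_types, lifting))
  then show ?thesis unfolding polar_isometry_def by (rule theI')
qed

section \<open>Partial isometries as contractions\<close>

lemma partial_isometry_norm_le:
  assumes V: "partial_isometry V"
  shows "norm (V x) \<le> norm x"
proof -
  have Vb: "bounded_clinear V" using V by (simp add: partial_isometry_def)
  obtain c n where c: "x = c + n" "V n = 0" "c \<in> orth_complement (null_space V)"
    using kernel_decomposition[OF Vb, of x] by metis
  have "V x = V c" by (simp add: c(1,2) bounded_clinearD[OF Vb])
  then have "norm (V x) = norm c" using V c(3) by (simp add: partial_isometry_def)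
  moreover have "cinner c n = 0"
    using c by (simp add: orth_complement_def null_space_def)
  then have "(norm x)\<^sup>2 = (norm c)\<^sup>2 + (norm n)\<^sup>2"
    by (simp add: c(1) norm_add_sq)
  then have "norm c \<le> norm x" by (simp add: power2_le_imp_le)
  ultimately show ?thesis by simp
qed

text \<open>Contractivity makes \<open>G\<close>, the identity minus \<open>cadjoint V\<close>
  composed with \<open>V\<close>, positive. Its form vanishes at \<open>u\<close>, so
  \<open>G u = 0\<close>: the initial space is fixed.\<close>

lemma partial_isometry_cinner:
  assumes V: "partial_isometry V" and u: "u \<in> orth_complement (null_space V)"
  shows "cinner (V u) (V x) = cinner u x"
proof -
  have Vb: "bounded_clinear V" using V by (simp add: partial_isometry_def)
  define G where "G y = y - cadjoint V (V y)" for y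
  have G: "cinner (G y) z = cinner y z - cinner (V y) (V z)" for y z
    by (simp add: G_def cinner_diff_left cinner_cadjoint_left[OF Vb])
  have "positive_op G"
  proof (rule positive_opI)
    show "bounded_clinear G"
      unfolding G_def[abs_def]
      by (rule bounded_clinear_diff[OF bounded_clinear_id
            bounded_clinear_compose[OF bounded_clinear_cadjoint[OF Vb] Vb]])
    show "cinner (G y) z = cinner y (G z)" for y z
      using G[of y z] G[of z y] by (metis cinner_commute complex_cnj_diff)
    show "0 \<le> Re (cinner (G y) y)" for y
      using partial_isometry_norm_le[OF V, of y] by (simp add: G cinner_self power_mono)
  qed
  moreover have "norm (V u) = norm u"
    using V u by (simp add: partial_isometry_def)
  then have "Re (cinner (G u) u) = 0" by (simp add: G cinner_self)
  ultimately have "G u = 0" by (rule positive_op_eq_zero)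
  then have "cinner (G u) x = 0" by simp
  then show ?thesis by (simp add: G)
qed

section \<open>Numerical radius\<close>

lemma cmod_cinner_le_numerical_radius:
  assumes T: "bounded_clinear T"
  shows "cmod (cinner (T x) x) \<le> numerical_radius T * (norm x)\<^sup>2"
proof (cases "x = 0")
  case False
  obtain K where K: "K > 0" "\<And>x. norm (T x) \<le> K * norm x"
    using bounded_clinear_bound[OF T] by blast
  have bdd: "bdd_above ((\<lambda>x. cmod (cinner (T x) x)) ` {x. norm x = 1})"
  proof (rule bdd_aboveI2)
    show "cmod (cinner (T y) y) \<le> K" if "y \<in> {y. norm y = 1}" for y
      using cmod_cinner_le[of "T y" y] K(2)[of y] that by simp
  qed
  define y where "y = (1 / norm x) *\<^sub>R x"
  have "norm y = 1" using False by (simp add: y_def)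
  then have "cmod (cinner (T y) y) \<le> numerical_radius T"
    unfolding numerical_radius_def by (intro cSUP_upper[OF _ bdd]) simp
  moreover have "cmod (cinner (T y) y) = cmod (cinner (T x) x) / (norm x)\<^sup>2"
    using False by (simp add: y_def bounded_clinearD[OF T] cinner_simps norm_mult norm_divide
        power2_eq_square)
  ultimately show ?thesis using False by (simp add: field_simps)
qed simp

text \<open>If there are no unit vectors, both radii are the same junk value.\<close>

lemma numerical_radius_mono:
  fixes S T :: "'a::complex_hilbert_space \<Rightarrow> 'a"
  assumes T: "bounded_clinear T"
    and le: "\<And>x. norm x = 1 \<Longrightarrow> cmod (cinner (S x) x) \<le> numerical_radius T"
  shows "numerical_radius S \<le> numerical_radius T"
proof (cases "{x::'a. norm x = 1} = {}")
  case True
  then show ?thesis by (simp add: numerical_radius_def)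
next
  case False
  show ?thesis
    unfolding numerical_radius_def[of S] by (rule cSUP_least[OF False]) (simp add: le)
qed

text \<open>A unit vector \<open>x\<close> nearly maximising the quadratic form of \<open>B X B\<close> is an approximate
  eigenvector of \<open>B X B\<close>; hence \<open>B x\<close> is one of \<open>B B X\<close>, for the same approximate eigenvalue.\<close>

lemma sandwich_quadratic_form_le:
  fixes B X :: "'a::complex_hilbert_space \<Rightarrow> 'a"
  assumes B: "positive_op B" and X: "bounded_clinear X"
    and X_sa: "\<And>x y. cinner (X x) y = cinner x (X y)"
    and m: "m \<ge> 0" "\<And>y. Re (cinner (B (B (X y))) y) \<le> m * (norm y)\<^sup>2"
    and u: "norm u = 1"
  shows "Re (cinner (B (X (B u))) u) \<le> m"
proof -
  note Bb = positive_opD(1)[OF B]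
  note Bs = bounded_clinearD[OF Bb]
  define H where "H x = B (X (B x))" for x
  have H: "bounded_clinear H"
    unfolding H_def[abs_def]
    by (rule bounded_clinear_compose[OF Bb bounded_clinear_compose[OF X Bb]])
  have H_sa: "cinner (H x) y = cinner x (H y)" for x y
    by (simp add: H_def positive_op_selfadjoint[OF B] X_sa)
  obtain b where b: "b > 0" "\<And>x. norm (B x) \<le> b * norm x"
    using bounded_clinear_bound[OF Bb] by blast
  obtain k where k: "k > 0" "\<And>x. norm (X x) \<le> k * norm x"
    using bounded_clinear_bound[OF X] by blast
  obtain h where h: "h > 0" "\<And>x. norm (H x) \<le> h * norm x"
    using bounded_clinear_bound[OF H] by blast
  let ?q = "\<lambda>x. Re (cinner (H x) x)" and ?S = "{x::'a. norm x = 1}"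
  define l where "l = (SUP x\<in>?S. ?q x)"
  have bdd: "bdd_above (?q ` ?S)"
  proof (rule bdd_aboveI2)
    show "?q y \<le> h" if "y \<in> ?S" for y
      using Re_cinner_le[of "H y" y] h(2)[of y] that by simp
  qed
  have l_unit: "?q x \<le> l" if "norm x = 1" for x
    unfolding l_def using that by (intro cSUP_upper[OF _ bdd]) simp
  have l_upper: "?q x \<le> l * (norm x)\<^sup>2" for x
  proof (cases "x = 0")
    case False
    then have "?q ((1 / norm x) *\<^sub>R x) \<le> l" by (intro l_unit) simp
    then show ?thesis
      using False by (simp add: bounded_clinearD[OF H] cinner_simps field_simps power2_eq_square)
  qed simp
  \<comment> \<open>Positivity of \<open>D\<close> converts a small gap \<open>l - ?q x\<close> into
    a small residual \<open>D x\<close>.\<close>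
  define D where "D x = l *\<^sub>R x - H x" for x
  have D: "positive_op D"
  proof (rule positive_opI)
    show "bounded_clinear D"
      unfolding D_def[abs_def]
      by (rule bounded_clinear_diff[OF bounded_clinear_scaleR[OF bounded_clinear_id] H])
    show "cinner (D x) y = cinner x (D y)" for x y
      by (simp add: D_def cinner_simps H_sa)
    show "0 \<le> Re (cinner (D x) x)" for x
      using l_upper[of x] by (simp add: D_def cinner_simps cinner_self)
  qed
  obtain K where K: "K > 0" "\<And>x. norm (D x) \<le> K * norm x"
    using bounded_clinear_bound[OF positive_opD(1)[OF D]] by blast
  have "l \<le> m"
  proof (rule ccontr)
    assume "\<not> l \<le> m"
    then have lm: "l - m > 0" by simp
    have "\<exists>x. norm x = 1 \<and> l - 1 / Suc n < ?q x" for n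
    proof -
      have "l - 1 / Suc n < (SUP x\<in>?S. ?q x)" by (simp add: l_def)
      then show ?thesis using u less_cSUP_iff[OF _ bdd] by blast
    qed
    then obtain x where x: "\<And>n. norm (x n) = 1" "\<And>n. l - 1 / Suc n < ?q (x n)" by metis
    have bound: "(l - m) * (l - 1 / Suc n) \<le> k * b\<^sup>2 * sqrt (K * (1 / Suc n))" for n
    proof -
      let ?x = "x n" and ?y = "B (x n)"
      have "Re (cinner (D ?x) ?x) \<le> 1 / Suc n"
        using x[of n] by (simp add: D_def cinner_simps cinner_self)
      then have "(norm (D ?x))\<^sup>2 \<le> K * (1 / Suc n)"
        using positive_op_norm_sq_le[OF D K, of ?x] K(1)
        by (meson mult_left_mono order_trans less_imp_le)
      then have D_small: "norm (D ?x) \<le> sqrt (K * (1 / Suc n))"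
        by (rule real_le_rsqrt)
      have "?q ?x = Re (cinner (X ?y) ?y)"
        by (simp add: H_def positive_op_selfadjoint[OF B])
      also have "\<dots> \<le> norm (X ?y) * norm ?y" by (rule Re_cinner_le)
      also have "\<dots> \<le> k * norm ?y * norm ?y" by (intro mult_right_mono k) simp
      \<comment> \<open>This keeps \<open>?y\<close> away from zero in the limit, so that it is a
        genuine approximate eigenvector.\<close>
      finally have y_large: "l - 1 / Suc n \<le> k * (norm ?y)\<^sup>2"
        using x(2)[of n] by (simp add: power2_eq_square mult.assoc)
      \<comment> \<open>Applying \<open>B\<close> to the near-eigenvalue equation for
        \<open>H\<close>.\<close>
      have "B (B (X ?y)) = l *\<^sub>R ?y - B (D ?x)"
        by (simp add: D_def Bs H_def)
      then have "l * (norm ?y)\<^sup>2 - Re (cinner (B (D ?x)) ?y) \<le> m * (norm ?y)\<^sup>2"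
        using m(2)[of ?y] by (simp add: cinner_simps cinner_self)
      moreover have "Re (cinner (B (D ?x)) ?y) \<le> norm (B (D ?x)) * norm ?y"
        by (rule Re_cinner_le)
      moreover have "\<dots> \<le> (b * norm (D ?x)) * (b * norm ?x)"
        using b by (intro mult_mono) simp_all
      ultimately have "(l - m) * (norm ?y)\<^sup>2 \<le> b\<^sup>2 * norm (D ?x)"
        using x(1)[of n] by (simp add: power2_eq_square algebra_simps)
      also have "\<dots> \<le> b\<^sup>2 * sqrt (K * (1 / Suc n))"
        by (intro mult_left_mono D_small) simp
      finally have "k * ((l - m) * (norm ?y)\<^sup>2) \<le> k * (b\<^sup>2 * sqrt (K * (1 / Suc n)))"
        using k(1) by (intro mult_left_mono) simp_all
      moreover have "(l - m) * (l - 1 / Suc n) \<le> (l - m) * (k * (norm ?y)\<^sup>2)"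
        using lm by (intro mult_left_mono y_large) simp
      ultimately show ?thesis by (simp add: mult_ac)
    qed
    \<comment> \<open>The limit of \<open>bound\<close> reads \<open>(l - m) * l \<le> 0\<close>,
      against \<open>l > m \<ge> 0\<close>.\<close>
    have "(l - m) * (l - 0) \<le> k * b\<^sup>2 * sqrt (K * 0)"
    proof (rule LIMSEQ_le)
      note lim = lim_1_over_n[THEN LIMSEQ_Suc]
      show "(\<lambda>n. (l - m) * (l - 1 / real (Suc n))) \<longlonglongrightarrow> (l - m) * (l - 0)"
        by (intro tendsto_mult tendsto_diff tendsto_const lim)
      show "(\<lambda>n. k * b\<^sup>2 * sqrt (K * (1 / real (Suc n)))) \<longlonglongrightarrow> k * b\<^sup>2 * sqrt (K * 0)"
        by (intro tendsto_mult tendsto_real_sqrt tendsto_const lim)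
    qed (use bound in blast)
    then show False using lm m(1) by (simp add: mult_le_0_iff)
  qed
  then show ?thesis using l_unit[OF u] by (simp add: H_def)
qed

text \<open>A Heinz-type inequality.  Multiplying \<open>V\<close> by a unimodular scalar and taking its real part
  reduces it to self-adjoint \<open>X\<close>.\<close>

lemma sandwich_numerical_radius_le:
  fixes B V :: "'a::complex_hilbert_space \<Rightarrow> 'a"
  assumes B: "positive_op B" and V: "bounded_clinear V"
    and m: "m \<ge> 0"
      "\<And>y. cmod (cinner ((1/2) *\<^sub>R (V (B (B y)) + B (B (V y)))) y) \<le> m * (norm y)\<^sup>2"
    and u: "norm u = 1"
  shows "cmod (cinner (B (V (B u))) u) \<le> m"
proof -
  note Bs = bounded_clinearD[OF positive_opD(1)[OF B]]
  obtain w where w: "cmod w = 1"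
    "w * cinner (B (V (B u))) u = complex_of_real (cmod (cinner (B (V (B u))) u))"
    by (rule exists_rotation)
  define U where "U y = w *\<^sub>C V y" for y
  have U: "bounded_clinear U"
    unfolding U_def[abs_def] by (rule bounded_clinear_scaleC[OF V])
  define X where "X y = (1/2) *\<^sub>R (U y + cadjoint U y)" for y
  have X: "bounded_clinear X"
    unfolding X_def[abs_def]
    by (rule bounded_clinear_scaleR[OF bounded_clinear_add[OF U bounded_clinear_cadjoint[OF U]]])
  have Re_X: "Re (cinner (X y) z) = (Re (cinner (U y) z) + Re (cinner (U z) y)) / 2" for y z
    using Re_cinner_commute[of y "U z"]
    by (simp add: X_def cinner_simps cinner_cadjoint_left[OF U])
  have "Re (cinner (B (X (B u))) u) \<le> m"
  proof (rule sandwich_quadratic_form_le[OF B X _ m(1) _ u])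
    show "cinner (X x) y = cinner x (X y)" for x y
      by (simp add: X_def cinner_simps cinner_cadjoint_left[OF U]
          cinner_cadjoint_right[OF U, symmetric])
    show "Re (cinner (B (B (X y))) y) \<le> m * (norm y)\<^sup>2" for y
    proof -
      have "Re (cinner (B (B (X y))) y) = Re (cinner (X y) (B (B y)))"
        by (simp add: positive_op_selfadjoint[OF B])
      \<comment> \<open>With \<open>z = B (B y)\<close>, the two halves of \<open>Re_X\<close>
        become the two summands of the mean, rotated by \<open>w\<close>.\<close>
      also have "\<dots> = Re (w * cinner ((1/2) *\<^sub>R (V (B (B y)) + B (B (V y)))) y)"
        by (simp add: Re_X U_def cinner_simps positive_op_selfadjoint[OF B] field_simps)
      also have "\<dots> \<le> cmod (w * cinner ((1/2) *\<^sub>R (V (B (B y)) + B (B (V y)))) y)"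
        by (rule complex_Re_le_cmod)
      also have "\<dots> \<le> m * (norm y)\<^sup>2"
        unfolding norm_mult w(1) using m(2)[of y] by simp
      finally show ?thesis .
    qed
  qed
  \<comment> \<open>Both arguments in \<open>Re_X\<close> equal \<open>B u\<close>, so its two
    halves coincide.\<close>
  moreover have "Re (cinner (B (X (B u))) u) = Re (w * cinner (B (V (B u))) u)"
    by (simp add: positive_op_selfadjoint[OF B] Re_X U_def cinner_simps)
  ultimately show ?thesis unfolding w(2) by simp
qed

section \<open>The two inequalities for the transforms\<close>

lemma numerical_radius_mean_transform_le:
  fixes T :: "'a::complex_hilbert_space \<Rightarrow> 'a"
  assumes T: "bounded_clinear T"
  shows "numerical_radius (mean_transform T) \<le> numerical_radius T"
proof (rule numerical_radius_mono[OF T])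
  fix x :: 'a assume x: "norm x = 1"
  define P V where "P = abs_op T" and "V = polar_isometry T"
  have P: "positive_op P" and norm_eq: "norm (P z) = norm (T z)" for z
    using abs_op_props[OF T] by (auto simp: P_def)
  have V: "partial_isometry V" and null_V: "null_space V = null_space T" and VP: "V (P z) = T z" for z
    using polar_isometry_props[OF T] unfolding P_def V_def by (auto simp: fun_eq_iff)
  have w: "cmod (cinner (T y) y) \<le> numerical_radius T * (norm y)\<^sup>2" for y
    by (rule cmod_cinner_le_numerical_radius[OF T])
  have "P y = 0" if "y \<in> null_space V" for y
    using that norm_eq[of y] unfolding null_V by (simp add: null_space_def)
  then have "P z \<in> orth_complement (null_space V)" for z
    by (simp add: orth_complement_def positive_op_selfadjoint[OF P])
  \<comment> \<open>\<open>P (V x)\<close> lies in the initial space of \<open>V\<close>, so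
    \<open>V\<close> may be applied to both arguments.\<close>
  then have "cinner (P (V x)) x = cinner (T (V x)) (V x)"
    using partial_isometry_cinner[OF V, of "P (V x)" x] by (simp add: VP)
  then have "cmod (cinner (P (V x)) x) \<le> numerical_radius T * (norm (V x))\<^sup>2"
    using w[of "V x"] by simp
  also have "\<dots> \<le> numerical_radius T * 1"
  proof (rule mult_left_mono)
    show "(norm (V x))\<^sup>2 \<le> 1"
      using partial_isometry_norm_le[OF V, of x] x by (simp add: power_le_one)
    show "0 \<le> numerical_radius T" using w[of x] x by (simp add: order_trans[OF norm_ge_zero])
  qed
  finally have "cmod (cinner (P (V x)) x) \<le> numerical_radius T" by simp
  moreover have "cmod (cinner (T x) x) \<le> numerical_radius T" using w[of x] x by simp
  ultimately have "cmod (cinner (T x) x + cinner (P (V x)) x) \<le> 2 * numerical_radius T"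
    using norm_triangle_ineq[of "cinner (T x) x" "cinner (P (V x)) x"] by linarith
  then show "cmod (cinner (mean_transform T x) x) \<le> numerical_radius T"
    by (simp add: mean_transform_def VP flip: P_def V_def) (simp add: cinner_simps norm_mult)
qed

lemma bounded_clinear_mean_transform:
  assumes T: "bounded_clinear T"
  shows "bounded_clinear (mean_transform T)"
proof -
  have P: "bounded_clinear (abs_op T)" and V: "bounded_clinear (polar_isometry T)"
    using abs_op_props[OF T] polar_isometry_props[OF T] positive_opD(1)
    by (auto simp: partial_isometry_def)
  show ?thesis
    unfolding mean_transform_def
    by (rule bounded_clinear_scaleR[OF bounded_clinear_add[OF bounded_clinear_compose[OF V P]
            bounded_clinear_compose[OF P V]]])
qed

lemma numerical_radius_aluthge_transform_le:
  fixes T :: "'a::complex_hilbert_space \<Rightarrow> 'a"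
  assumes T: "bounded_clinear T"
  shows "numerical_radius (aluthge_transform T) \<le> numerical_radius (mean_transform T)"
proof (rule numerical_radius_mono[OF bounded_clinear_mean_transform[OF T]])
  fix x :: 'a assume x: "norm x = 1"
  define B V where "B = sqrt_op (abs_op T)" and "V = polar_isometry T"
  have B: "positive_op B" and BB: "B (B z) = abs_op T z" for z
    using sqrt_op_props[of "abs_op T"] abs_op_props[OF T] unfolding B_def by (auto simp: fun_eq_iff)
  have V: "bounded_clinear V"
    using polar_isometry_props[OF T] by (simp add: V_def partial_isometry_def)
  note w = cmod_cinner_le_numerical_radius[OF bounded_clinear_mean_transform[OF T]]
  have "cmod (cinner (B (V (B x))) x) \<le> numerical_radius (mean_transform T)"
  proof (rule sandwich_numerical_radius_le[OF B V _ _ x])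
    \<comment> \<open>Nonnegativity is drawn from the unit vector \<open>x\<close>; on the zero
      space the radius is an unspecified constant.\<close>
    show "0 \<le> numerical_radius (mean_transform T)"
      using order_trans[OF norm_ge_zero w[of x]] x by simp
    show "cmod (cinner ((1/2) *\<^sub>R (V (B (B y)) + B (B (V y)))) y)
        \<le> numerical_radius (mean_transform T) * (norm y)\<^sup>2" for y
      \<comment> \<open>Since \<open>B\<close> squares to \<open>abs_op T\<close>, the symmetrised
        operator is the mean transform itself.\<close>
      using w[of y] by (simp only: BB mean_transform_def V_def)
  qed
  then show "cmod (cinner (aluthge_transform T x) x) \<le> numerical_radius (mean_transform T)"
    by (simp add: aluthge_transform_def B_def V_def)
qed

theorem corollary3p3:
  fixes T :: "'a::complex_hilbert_space \<Rightarrow> 'a"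
  assumes "bounded_clinear T"
  shows "numerical_radius (aluthge_transform T) \<le> numerical_radius (mean_transform T)
       \<and> numerical_radius (mean_transform T) \<le> numerical_radius T"
  using numerical_radius_aluthge_transform_le[OF assms]
    numerical_radius_mean_transform_le[OF assms] by blast

end
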